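(* For every integer $n \geq 10$, $\prod_{i=1}^{n} p_i > p_{n+1}^6$, and for every integer $n \geq 8$, $\prod_{i=1}^{n} p_i > p_{n+1}^5$.
   Context: $p_n$ denotes the $n$th prime (so $p_1 = 2$, $p_2 = 3$, $p_3 = 5$, ...). *)

theory Defs
  imports "HOL-Library.Infinite_Set" "HOL-Computational_Algebra.Primes"
begin

(* The library function enumerate starts at index 0, whereas the primes are indexed from 1.
   The value at index 0 is junk (it coincides with the first prime). *)
definition nth_prime :: "nat \<Rightarrow> nat" where
  "nth_prime n = enumerate {p. prime p} (n - 1)"

end

theory Submission
  imports Defs "HOL-Library.Discrete_Functions"
begin

text \<open>
  It suffices to bound the product \<open>P\<close> of all primes below a prime \<open>q\<close> from below by \<open>q ^ 6\<close>,
  which is a weak form of Chebyshev's theorem. Put \<open>N = q - 1\<close>. The product \<open>L\<close> of the largest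
  prime powers not exceeding \<open>N\<close> is a common multiple of \<open>1, \<dots>, N\<close>, hence a multiple of all
  the numbers \<open>(r + 1) * (r choose j)\<close> with \<open>r < N\<close>; a central binomial coefficient gives
  \<open>2 ^ N \<le> 4 * L\<close>. Only primes up to \<open>sqrt N\<close> occur in \<open>L\<close> with exponent above one, so
  \<open>L \<le> P * N ^ sqrt N\<close>. This is enough for \<open>q \<ge> 256\<close>, and below that a few explicit partial
  products suffice.
\<close>

section \<open>Common multiples of 1, ..., N\<close>

text \<open>
  The reciprocals of the numbers \<open>(r + 1) * (r choose j)\<close> form Leibniz's harmonic triangle:
  each entry is a difference of two entries with smaller \<open>j\<close>, so all of them are integer
  multiples of \<open>1 / L\<close> once the entries \<open>1 / (r + 1)\<close> for \<open>j = 0\<close> are.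
\<close>
lemma Suc_times_binomial_dvd_common_multiple:
  fixes L :: nat
  assumes "\<And>k. 1 \<le> k \<Longrightarrow> k \<le> N \<Longrightarrow> k dvd L"
  shows "j \<le> r \<Longrightarrow> r < N \<Longrightarrow> Suc r * (r choose j) dvd L"
proof (induction j arbitrary: r)
  case 0
  then show ?case using assms[of "Suc r"] by simp
next
  case (Suc j)
  then obtain t where r: "r = Suc t" "j \<le> t" by (cases r) auto
  define A B D where "A = int (Suc r * (r choose j))" and "B = int (Suc t * (t choose j))"
    and "D = int (Suc r * (r choose Suc j))"
  have "A dvd int L" "B dvd int L"
    using Suc.IH[of r] Suc.IH[of t] Suc.prems r
    unfolding A_def B_def by (simp_all only: of_nat_dvd_iff)
  then obtain a b where ab: "int L = A * a" "int L = B * b" by (auto elim!: dvdE)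
  have "A = int (Suc j * (Suc r choose Suc j))"
    unfolding A_def using Suc_times_binomial[of j r] by metis
  then have A: "A = int (Suc j) * (int (r choose j) + int (r choose Suc j))"
    by (simp add: algebra_simps)
  have B: "B = int (Suc j) * int (r choose Suc j)"
    unfolding B_def r(1) using Suc_times_binomial[of j t] by (metis of_nat_mult)
  have D: "D = int (Suc r) * int (r choose Suc j)"
    unfolding D_def by (simp only: of_nat_mult)
  have A': "A = int (Suc r) * int (r choose j)"
    unfolding A_def by (simp only: of_nat_mult)
  have "A - B = int (Suc j) * int (r choose j)"
    unfolding A B by (simp add: algebra_simps)
  \<comment> \<open>This is \<open>1 / D = 1 / B - 1 / A\<close> cleared of denominators, so
    \<open>L / D\<close> is the integer \<open>b - a\<close>.\<close>
  then have AB: "A * B = D * (A - B)"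
    unfolding D using A' B by (simp only: ac_simps)
  have nz: "A * B \<noteq> 0"
  proof -
    have "Suc r * (r choose j) > 0" "Suc t * (t choose j) > 0" using r by simp_all
    then show ?thesis unfolding A_def B_def by (metis less_irrefl mult_eq_0_iff of_nat_eq_0_iff)
  qed
  have "A * B * (D * (b - a)) = D * (A * (B * b) - B * (A * a))"
    by (simp add: algebra_simps)
  also have "\<dots> = D * (A - B) * int L"
    using ab by (simp add: algebra_simps)
  also have "\<dots> = A * B * int L" by (simp add: AB)
  finally have "int L = D * (b - a)" using nz by (metis mult_left_cancel)
  then have "D dvd int L" by simp
  then show ?case unfolding D_def by (simp only: of_nat_dvd_iff)
qed

lemma two_power_le_common_multiple:
  fixes L :: nat
  assumes dvd: "\<And>k. 1 \<le> k \<Longrightarrow> k \<le> N \<Longrightarrow> k dvd L" and "L > 0" "N \<ge> 3"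
  shows "2 ^ N \<le> 4 * L"
proof -
  \<comment> \<open>\<open>2 * m\<close> is the largest even number below \<open>N\<close>, the last
    even row covered by the previous lemma. It misses \<open>N\<close> by at most 2, which costs the
    factor 4.\<close>
  define m where "m = (N - 1) div 2"
  have m: "m > 0" "2 * m < N" "N \<le> 2 + 2 * m" using \<open>N \<ge> 3\<close> by (auto simp: m_def)
  have "real (4 ^ m) \<le> real ((2 * m choose m) * (2 * m))"
    using central_binomial_lower_bound[OF m(1)] m(1) by (simp add: field_simps)
  then have "4 ^ m \<le> (2 * m choose m) * (2 * m)" by (simp only: of_nat_le_iff)
  also have "\<dots> \<le> Suc (2 * m) * (2 * m choose m)" by simp
  also have "\<dots> \<le> L"
    using Suc_times_binomial_dvd_common_multiple[of N L m "2 * m"] dvd m \<open>L > 0\<close>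
    by (intro dvd_imp_le) auto
  finally have "4 ^ m \<le> L" .
  have "(2::nat) ^ N \<le> 2 ^ (2 + 2 * m)" using m by (intro power_increasing) auto
  also have "\<dots> = 4 * 4 ^ m" by (simp add: power_add power_mult)
  finally show ?thesis using \<open>4 ^ m \<le> L\<close> by linarith
qed

section \<open>Lower bound for the primorial\<close>

lemma two_power_le_primorial:
  fixes N s :: nat
  assumes "N \<ge> 3" "N < (s + 1)\<^sup>2"
  shows "2 ^ N \<le> 4 * (\<Prod>{p. prime p \<and> p \<le> N} * N ^ s)"
proof -
  define S where "S = {p::nat. prime p \<and> p \<le> N}"
  define e where "e p = Max {k. p ^ k \<le> N}" for p
  define L where "L = (\<Prod>p\<in>S. p ^ e p)"
  have [simp]: "finite S" unfolding S_def by simp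
  have fin: "finite {k. p ^ k \<le> N}" if "prime p" for p
  proof (rule finite_subset)
    show "{k. p ^ k \<le> N} \<subseteq> {..N}"
    proof safe
      fix k assume "p ^ k \<le> N"
      then show "k \<le> N"
        using power_gt_expt[of p k] prime_gt_1_nat[OF that] by simp
    qed
  qed simp
  have e_le: "p ^ e p \<le> N" if "prime p" for p
  proof -
    have "0 \<in> {k. p ^ k \<le> N}" using \<open>N \<ge> 3\<close> by simp
    then show ?thesis using Max_in[OF fin[OF that]] unfolding e_def by blast
  qed
  have e_max: "k \<le> e p" if "prime p" "p ^ k \<le> N" for p k
    unfolding e_def using fin[OF that(1)] that by (intro Max_ge) auto
  have Lpos: "L > 0"
    unfolding L_def S_def by (intro prod_pos) (auto simp: prime_gt_0_nat)
  have "k dvd L" if k: "1 \<le> k" "k \<le> N" for k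
  proof -
    have sub: "prime_factors k \<subseteq> S"
    proof
      fix p assume "p \<in> prime_factors k"
      then have "prime p" "p dvd k" by (auto simp: prime_factors_dvd)
      then show "p \<in> S" using k dvd_imp_le[of p k] by (simp add: S_def)
    qed
    have "k = (\<Prod>p\<in>prime_factors k. p ^ multiplicity p k)"
      using prime_factorization_nat[of k] k by simp
    also have "\<dots> dvd (\<Prod>p\<in>prime_factors k. p ^ e p)"
    proof (rule prod_dvd_prod)
      fix p assume p: "p \<in> prime_factors k"
      have "p ^ multiplicity p k \<le> k" using k by (intro dvd_imp_le multiplicity_dvd) auto
      with p k show "p ^ multiplicity p k dvd p ^ e p"
        by (intro le_imp_power_dvd e_max) auto
    qed
    also have "\<dots> dvd L" unfolding L_def using sub by (intro prod_dvd_prod_subset) auto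
    finally show ?thesis .
  qed
  then have "2 ^ N \<le> 4 * L"
    using two_power_le_common_multiple Lpos \<open>N \<ge> 3\<close> by blast
  \<comment> \<open>One factor \<open>p\<close> is kept for every prime, so that the primorial
    splits off. A prime above the square root has \<open>e p < 2\<close> and needs nothing
    more.\<close>
  also have "L \<le> (\<Prod>p\<in>S. p * (if p\<^sup>2 \<le> N then N else 1))"
    unfolding L_def
  proof (rule prod_mono, safe)
    fix p assume "p \<in> S"
    then have p: "prime p" "p > 1" using prime_gt_1_nat by (auto simp: S_def)
    show "p ^ e p \<le> p * (if p\<^sup>2 \<le> N then N else 1)"
    proof (cases "p\<^sup>2 \<le> N")
      case True
      have "1 * N \<le> p * N" using p by (intro mult_right_mono) auto
      then have "p ^ e p \<le> p * N" using e_le[OF p(1)] by linarith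
      then show ?thesis using True by simp
    next
      case False
      have "e p < 2"
      proof (rule ccontr)
        assume "\<not> e p < 2"
        then have "p ^ 2 \<le> p ^ e p" using p by (intro power_increasing) auto
        then show False using False e_le[OF p(1)] by simp
      qed
      then have "p ^ e p \<le> p ^ 1" using p by (intro power_increasing) auto
      then show ?thesis using False by simp
    qed
  qed
  also have "\<dots> = \<Prod>S * (\<Prod>p\<in>{p\<in>S. p\<^sup>2 \<le> N}. N)"
    by (simp only: prod.distrib prod.inter_filter[OF \<open>finite S\<close>])
  also have "\<dots> \<le> \<Prod>S * N ^ s"
  proof -
    have "{p\<in>S. p\<^sup>2 \<le> N} \<subseteq> {1..s}"
    proof safe
      fix p assume "p \<in> S" "p\<^sup>2 \<le> N"
      then have "p\<^sup>2 < (s + 1)\<^sup>2" using assms by linarith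
      then have "p < s + 1" by (rule power_less_imp_less_base) simp
      then show "p \<in> {1..s}" using \<open>p \<in> S\<close> prime_ge_1_nat[of p] by (simp add: S_def)
    qed
    from card_mono[OF _ this] have "card {p\<in>S. p\<^sup>2 \<le> N} \<le> s" by simp
    then show ?thesis using \<open>N \<ge> 3\<close> by (simp add: power_increasing)
  qed
  finally show ?thesis unfolding S_def by simp
qed

section \<open>The sixth power bound\<close>

lemma Suc_power4_le_two_power:
  fixes s :: nat
  assumes "s \<ge> 16"
  shows "(s + 1) ^ 4 \<le> 2 ^ (s + 4)"
  using assms
proof (induction s rule: dec_induct)
  case base
  show ?case by simp
next
  case (step s)
  \<comment> \<open>The ratio 7/6 suffices because \<open>7 ^ 4 = 2401\<close> is less than
    \<open>2 * 6 ^ 4 = 2592\<close>.\<close>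
  have "6 * (Suc s + 1) \<le> 7 * (s + 1)" using step by simp
  then have "(6 * (Suc s + 1)) ^ 4 \<le> (7 * (s + 1)) ^ 4" by (rule power_mono) simp
  then have "1296 * (Suc s + 1) ^ 4 \<le> 2401 * (s + 1) ^ 4" by (simp only: power_mult_distrib) simp
  moreover have "(2::nat) ^ (Suc s + 4) = 2 * 2 ^ (s + 4)" by (simp only: add_Suc power_Suc)
  ultimately show ?case using step.IH by linarith
qed

text \<open>By the primorial bound for \<open>N = q - 1\<close> it is enough that
  \<open>q ^ (s + 6) < 2 ^ (q - 3)\<close>, where \<open>s\<close> is the integer square root of
  \<open>q\<close>: the power \<open>q ^ s\<close> absorbs \<open>(q - 1) ^ s\<close>, and the
  factor 4 lowers the exponent from \<open>q - 1\<close> to \<open>q - 3\<close>.\<close>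

lemma power6_less_primorial_large:
  fixes q :: nat
  assumes "q \<ge> 256"
  shows "q ^ 6 < \<Prod>{p. prime p \<and> p < q}"
proof -
  obtain s where s: "s\<^sup>2 \<le> q" "q < (s + 1)\<^sup>2"
    using floor_sqrt_power2_le[of q] Suc_floor_sqrt_power2_gt[of q] by (metis Suc_eq_plus1)
  have s16: "s \<ge> 16"
  proof (rule ccontr)
    assume "\<not> s \<ge> 16"
    then have "(s + 1)\<^sup>2 \<le> 16\<^sup>2" by (intro power_mono) auto
    then show False using s assms by simp
  qed
  have exps: "(s + 4) * (s + 6) \<le> 2 * (q - 3)"
  proof -
    have "16 * s \<le> s\<^sup>2" using s16 by (simp add: power2_eq_square)
    moreover have "(s + 4) * (s + 6) = s\<^sup>2 + 10 * s + 24"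
      by (simp add: power2_eq_square algebra_simps)
    ultimately show ?thesis using s s16 by linarith
  qed
  \<comment> \<open>Squaring produces the fourth power of \<open>s + 1\<close>, which is at most
    \<open>2 ^ (s + 4)\<close>; \<open>exps\<close> compares the resulting exponents.\<close>
  have "(q ^ (s + 6))\<^sup>2 < (((s + 1)\<^sup>2) ^ (s + 6))\<^sup>2"
    using s by (intro power_strict_mono) auto
  also have "\<dots> = ((s + 1) ^ 4) ^ (s + 6)"
    by (simp only: power_mult[symmetric]) (simp add: mult_ac)
  also have "\<dots> \<le> (2 ^ (s + 4)) ^ (s + 6)"
    using Suc_power4_le_two_power[OF s16] by (intro power_mono) auto
  also have "\<dots> = 2 ^ ((s + 4) * (s + 6))" by (simp only: power_mult)
  also have "\<dots> \<le> 2 ^ (2 * (q - 3))" using exps by (intro power_increasing) auto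
  also have "\<dots> = (2 ^ (q - 3))\<^sup>2" by (simp only: power_mult[symmetric] mult.commute)
  finally have "q ^ (s + 6) < 2 ^ (q - 3)" by (rule power_less_imp_less_base) simp
  moreover have "(2::nat) ^ (q - 1) = 4 * 2 ^ (q - 3)"
  proof -
    have "q - 1 = 2 + (q - 3)" using assms by simp
    then show ?thesis by (simp only: power_add) simp
  qed
  moreover have "2 ^ (q - 1) \<le> 4 * (\<Prod>{p. prime p \<and> p < q} * (q - 1) ^ s)"
  proof -
    have "{p. prime p \<and> p < q} = {p. prime p \<and> p \<le> q - 1}" using assms by auto
    then show ?thesis using two_power_le_primorial[of "q - 1" s] assms s by simp
  qed
  moreover have "\<Prod>{p. prime p \<and> p < q} * (q - 1) ^ s \<le> \<Prod>{p. prime p \<and> p < q} * q ^ s"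
    by (intro mult_left_mono power_mono) auto
  ultimately have "q ^ (s + 6) < \<Prod>{p. prime p \<and> p < q} * q ^ s" by linarith
  then have "q ^ 6 * q ^ s < \<Prod>{p. prime p \<and> p < q} * q ^ s"
    by (simp only: power_add mult.commute)
  then show ?thesis by simp
qed

lemma prod_le_primorial:
  fixes q :: nat
  assumes "A \<subseteq> {p. prime p \<and> p < q}"
  shows "\<Prod>A \<le> \<Prod>{p. prime p \<and> p < q}"
  using assms by (intro dvd_imp_le prod_dvd_prod_subset prod_pos) (auto simp: prime_gt_0_nat)

lemma power6_less_primorial:
  fixes q :: nat
  assumes "q \<ge> 30"
  shows "q ^ 6 < \<Prod>{p. prime p \<and> p < q}"
proof -
  \<comment> \<open>The primes up to 41 have a product just above \<open>256 ^ 6\<close>, and those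
    up to 29 a product just above \<open>42 ^ 6\<close>.\<close>
  consider "q \<ge> 256" | "42 \<le> q" "q \<le> 256" | "q \<le> 42" by linarith
  then show ?thesis
  proof cases
    case 1
    then show ?thesis by (rule power6_less_primorial_large)
  next
    case 2
    then have "q ^ 6 \<le> 256 ^ 6" by (intro power_mono) auto
    also have "\<dots> < \<Prod>{2, 3, 5, 7, 11, 13, 17, 19, 23, 29, 31, 37, 41::nat}" by simp
    also have "\<dots> \<le> \<Prod>{p. prime p \<and> p < q}" using 2 by (intro prod_le_primorial) auto
    finally show ?thesis .
  next
    case 3
    then have "q ^ 6 \<le> 42 ^ 6" by (intro power_mono) auto
    also have "\<dots> < \<Prod>{2, 3, 5, 7, 11, 13, 17, 19, 23, 29::nat}" by simp
    also have "\<dots> \<le> \<Prod>{p. prime p \<and> p < q}" using assms by (intro prod_le_primorial) auto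
    finally show ?thesis .
  qed
qed

lemma power5_less_primorial:
  fixes q :: nat
  assumes "prime q" "q \<ge> 20"
  shows "q ^ 5 < \<Prod>{p. prime p \<and> p < q}"
proof -
  \<comment> \<open>From 30 on the sixth power bound applies, which leaves only two primes to
    check.\<close>
  have "\<forall>p\<in>{..<30::nat}. prime p \<longrightarrow> p < 20 \<or> p = 23 \<or> p = 29"
    by (simp add: lessThan_nat_numeral)
  then consider "q \<ge> 30" | "q = 23" | "q = 29"
    using assms by (metis lessThan_iff not_less)
  then show ?thesis
  proof cases
    case 1
    then have "q ^ 5 \<le> q ^ 6" by (intro power_increasing) auto
    then show ?thesis using power6_less_primorial[OF 1] by linarith
  next
    case 2
    then have "q ^ 5 < \<Prod>{2, 3, 5, 7, 11, 13, 17, 19::nat}" by simp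
    also have "\<dots> \<le> \<Prod>{p. prime p \<and> p < q}" using 2 by (intro prod_le_primorial) auto
    finally show ?thesis .
  next
    case 3
    then have "q ^ 5 < \<Prod>{2, 3, 5, 7, 11, 13, 17, 19, 23::nat}" by simp
    also have "\<dots> \<le> \<Prod>{p. prime p \<and> p < q}" using 3 by (intro prod_le_primorial) auto
    finally show ?thesis .
  qed
qed

section \<open>Transfer to the indexed primes\<close>

lemma nth_prime_Suc_prime: "prime (nth_prime (n + 1))"
  using enumerate_in_set[OF primes_infinite] by (simp add: nth_prime_def)

text \<open>On positive indices \<open>nth_prime\<close> is the strictly increasing enumeration
  shifted by one. Index 0 is excluded since it repeats the first prime.\<close>

lemma bij_betw_nth_prime: "bij_betw nth_prime {1..n} {p. prime p \<and> p < nth_prime (n + 1)}"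
proof (rule bij_betwI')
  fix i j assume "i \<in> {1..n}" "j \<in> {1..n}"
  then show "(nth_prime i = nth_prime j) = (i = j)"
    using inj_enumerate[OF primes_infinite]
    by (fastforce simp: nth_prime_def dest: injD)
next
  fix i assume "i \<in> {1..n}"
  then show "nth_prime i \<in> {p. prime p \<and> p < nth_prime (n + 1)}"
    using enumerate_in_set[OF primes_infinite] enumerate_mono[OF _ primes_infinite]
    by (auto simp: nth_prime_def)
next
  fix p assume "p \<in> {p. prime p \<and> p < nth_prime (n + 1)}"
  moreover from this obtain k where "enumerate {p. prime p} k = p"
    using enumerate_Ex[OF primes_infinite, of p] by auto
  ultimately show "\<exists>i\<in>{1..n}. p = nth_prime i"
    using enumerate_mono_iff[OF primes_infinite, of k n]
    by (intro bexI[of _ "k + 1"]) (auto simp: nth_prime_def)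
qed

lemma prod_nth_prime: "(\<Prod>i = 1..n. nth_prime i) = \<Prod>{p. prime p \<and> p < nth_prime (n + 1)}"
  using prod.reindex_bij_betw[OF bij_betw_nth_prime, of "\<lambda>p. p" n] by simp

text \<open>Otherwise \<open>A\<close> would contain the prime with index \<open>n + 1\<close>
  together with the \<open>n\<close> primes below it, which is one element too many. This turns a
  lower bound on \<open>n\<close> into one on the next prime.\<close>

lemma nth_prime_Suc_ge:
  assumes "{p. prime p \<and> p < b} \<subseteq> A" "finite A" "card A \<le> n"
  shows "b \<le> nth_prime (n + 1)"
proof (rule ccontr)
  define q where "q = nth_prime (n + 1)"
  assume "\<not> b \<le> nth_prime (n + 1)"
  then have "insert q {p. prime p \<and> p < q} \<subseteq> A"
    using assms(1) nth_prime_Suc_prime[of n] by (force simp: q_def)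
  then have "card (insert q {p. prime p \<and> p < q}) \<le> card A"
    using assms(2) by (rule card_mono[rotated])
  moreover have "card {p. prime p \<and> p < q} = n"
    using bij_betw_same_card[OF bij_betw_nth_prime, of n] by (simp add: q_def)
  ultimately show False using assms(3) by simp
qed

theorem mainTheorem4:
  shows "(\<forall>n::nat. n \<ge> 10 \<longrightarrow> (\<Prod>i = 1..n. nth_prime i) > nth_prime (n + 1) ^ 6) \<and>
         (\<forall>n::nat. n \<ge> 8 \<longrightarrow> (\<Prod>i = 1..n. nth_prime i) > nth_prime (n + 1) ^ 5)"
proof (intro conjI allI impI)
  fix n :: nat assume n: "n \<ge> 10"
  have "\<forall>p\<in>{..<30}. prime p \<longrightarrow> p \<in> {2, 3, 5, 7, 11, 13, 17, 19, 23, 29::nat}"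
    by (simp add: lessThan_nat_numeral)
  then have "{p. prime p \<and> p < 30} \<subseteq> {2, 3, 5, 7, 11, 13, 17, 19, 23, 29::nat}"
    by blast
  from nth_prime_Suc_ge[OF this] have "nth_prime (n + 1) \<ge> 30" using n by simp
  then show "(\<Prod>i = 1..n. nth_prime i) > nth_prime (n + 1) ^ 6"
    unfolding prod_nth_prime by (rule power6_less_primorial)
next
  fix n :: nat assume n: "n \<ge> 8"
  have "\<forall>p\<in>{..<20}. prime p \<longrightarrow> p \<in> {2, 3, 5, 7, 11, 13, 17, 19::nat}"
    by (simp add: lessThan_nat_numeral)
  then have "{p. prime p \<and> p < 20} \<subseteq> {2, 3, 5, 7, 11, 13, 17, 19::nat}"
    by blast
  from nth_prime_Suc_ge[OF this] have "nth_prime (n + 1) \<ge> 20" using n by simp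
  with nth_prime_Suc_prime show "(\<Prod>i = 1..n. nth_prime i) > nth_prime (n + 1) ^ 5"
    unfolding prod_nth_prime by (rule power5_less_primorial)
qed

end
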